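(* Let $G\subset GL_2(\mathbb R)$ be a finite subgroup which is not generated in codimension $1$. Then $\mathcal R_1G$ is the trivial group and, up to conjugation in $GL_2(\mathbb R)$, $$G=\mu_2(n):=\mathcal R_2I_2(n)$$ for some $n\geq 2$. Moreover, the lattice $\mathcal L(\mathcal A^G)$ consists only of the origin $O$ and the full space $V=\mathbb R^2$.
   Context: For $g\in G$, $V^{\langle g\rangle}$ is the subspace of vectors of $V=\mathbb R^2$ fixed by $g$; for a subgroup $H\subset G$, $V^H$ is the subspace of vectors fixed by every element of $H$. $G$ is generated in codimension $1$ if it is generated by its elements $g$ with $\operatorname{codim}V^{\langle g\rangle}\le 1$. $\mathcal R_1G$ (resp. $\mathcal R_2G$) is the subgroup of $G$ generated by its reflections, i.e. its elements with $\operatorname{codim}V^{\langle g\rangle}=1$ (resp. by its rotations, i.e. its elements with $\operatorname{codim}V^{\langle g\rangle}=2$). For $n\ge 2$, $I_2(n)\subset O_2(\mathbb R)$ is the dihedral reflection group of order $2n$: the symmetry group of $n$ equidistant points on the unit circle if $n\geq3$, and $\{\operatorname{diag}(\pm1,\pm1)\}$ if $n=2$. A subgroup $H\subset G$ is a stabilizer subgroup if $H=\{g\in G\mid gv=v\ \text{for all } v\in V^H\}$. The subspace arrangement of $G$ is $\mathcal A^G=\{V^H\mid \{e\}\neq H \text{ a stabilizer subgroup}\}$, and $\mathcal L(\mathcal A^G)$ is the set of all intersections of subfamilies of $\mathcal A^G$ (the empty intersection being $V$), ordered by reverse inclusion. *)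

theory Defs
  imports "HOL-Analysis.Analysis" "HOL-Algebra.Generated_Groups"
begin

definition GL :: "(real^'n^'n) monoid"
  where "GL = \<lparr>carrier = {A. invertible A}, mult = (**), one = mat 1\<rparr>"

lemma group_GL: "group (GL :: (real^'n^'n) monoid)"
proof (rule groupI)
  fix A :: "real^'n^'n"
  assume "A \<in> carrier GL"
  then obtain B where "A ** B = mat 1" "B ** A = mat 1"
    by (auto simp: GL_def invertible_def)
  then show "\<exists>B\<in>carrier GL. B \<otimes>\<^bsub>GL\<^esub> A = \<one>\<^bsub>GL\<^esub>"
    by (intro bexI[of _ B]) (auto simp: GL_def invertible_def)
qed (auto simp: GL_def invertible_mult matrix_mul_assoc invertible_def[of "mat 1"])

definition fixed_space :: "(real^'n^'n) set \<Rightarrow> (real^'n) set"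
  where "fixed_space H = {v. \<forall>g\<in>H. g *v v = v}"

text \<open>No truncation occurs: \<open>dim S\<close>, the dimension of the span of \<open>S\<close>, is at most
  \<open>DIM('a)\<close>.\<close>

definition codim :: "'a::euclidean_space set \<Rightarrow> nat"
  where "codim S = DIM('a) - dim S"

text \<open>For \<open>G\<close> a subgroup of \<open>GL\<close> and \<open>S \<subseteq> G\<close>, generating inside \<open>GL\<close> is the
  same as generating inside \<open>G\<close>.\<close>

definition generated_in_codim_1 :: "(real^'n^'n) set \<Rightarrow> bool"
  where "generated_in_codim_1 G \<longleftrightarrow>
    G = generate GL {g \<in> G. codim (fixed_space {g}) \<le> 1}"

definition reflection_subgroup :: "(real^'n^'n) set \<Rightarrow> (real^'n^'n) set" (\<open>\<R>\<^sub>1\<close>)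
  where "\<R>\<^sub>1 G = generate GL {g \<in> G. codim (fixed_space {g}) = 1}"

definition rotation_subgroup :: "(real^'n^'n) set \<Rightarrow> (real^'n^'n) set" (\<open>\<R>\<^sub>2\<close>)
  where "\<R>\<^sub>2 G = generate GL {g \<in> G. codim (fixed_space {g}) = 2}"

definition circle_points :: "nat \<Rightarrow> (real^2) set"
  where "circle_points n =
    (\<lambda>k. vector [cos (2 * pi * real k / real n), sin (2 * pi * real k / real n)]) ` {..<n}"

text \<open>The dihedral reflection group of order \<open>2 * n\<close>, meaningful for \<open>n \<ge> 2\<close> only. The symmetry
  group of two antipodal points also consists of the matrices \<open>diag(\<plusminus>1, \<plusminus>1)\<close>, but the
  case \<open>n = 2\<close> is kept separate to match the usual definition.\<close>

definition I\<^sub>2 :: "nat \<Rightarrow> (real^2^2) set"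
  where "I\<^sub>2 n =
    (if n = 2 then {vector [vector [a, 0], vector [0, b]] | a b. a \<in> {1, -1} \<and> b \<in> {1, -1}}
     else {A. orthogonal_matrix A \<and> (*v) A ` circle_points n = circle_points n})"

definition \<mu>\<^sub>2 :: "nat \<Rightarrow> (real^2^2) set"
  where "\<mu>\<^sub>2 n = \<R>\<^sub>2 (I\<^sub>2 n)"

definition conjugate_in_GL :: "(real^'n^'n) set \<Rightarrow> (real^'n^'n) set \<Rightarrow> bool"
  where "conjugate_in_GL G H \<longleftrightarrow>
    (\<exists>P\<in>carrier GL. G = (\<lambda>A. P ** A ** matrix_inv P) ` H)"

definition stabilizer_subgroup :: "(real^'n^'n) set \<Rightarrow> (real^'n^'n) set \<Rightarrow> bool"
  where "stabilizer_subgroup G H \<longleftrightarrow>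
    subgroup H GL \<and> H \<subseteq> G \<and> H = {g \<in> G. \<forall>v\<in>fixed_space H. g *v v = v}"

definition arrangement :: "(real^'n^'n) set \<Rightarrow> (real^'n) set set"
  where "arrangement G = {fixed_space H | H. stabilizer_subgroup G H \<and> H \<noteq> {mat 1}}"

text \<open>The empty intersection \<open>\<Inter>{}\<close> is the full space \<open>UNIV\<close>; the order is reverse inclusion.\<close>

definition intersection_lattice :: "(real^'n) set set \<Rightarrow> (real^'n) set gorder" (\<open>\<L>\<close>)
  where "\<L> \<A> = \<lparr>carrier = {\<Inter>\<F> | \<F>. \<F> \<subseteq> \<A>}, eq = (=), le = (\<lambda>X Y. Y \<subseteq> X)\<rparr>"

end

theory Submission
  imports Defs
begin

text \<open>Averaging the inner product over \<open>G\<close> conjugates \<open>G\<close> into the orthogonal group, whose elements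
  are complex multiplications by a unit \<open>z\<close> and the maps \<open>w \<mapsto> z * cnj w\<close>; the latter fix a square
  root of \<open>z\<close>. If \<open>G\<close> contains one such reflection \<open>s\<close>, then every \<open>g \<in> G\<close> is a reflection or a
  product of the reflections \<open>g s\<close> and \<open>s\<^sup>-\<^sup>1\<close>, so \<open>G\<close> is generated in codimension 1. Otherwise \<open>G\<close> is a
  finite group of unit complex numbers, hence the group of \<open>n\<close>-th roots of unity with \<open>n = card G\<close>, and
  none of its nontrivial elements has a nonzero fixed vector.\<close>

section \<open>Fixed spaces\<close>

lemma zero_in_fixed_space: "0 \<in> fixed_space H"
  by (simp add: fixed_space_def)

text \<open>A fixed space contains 0, and \<open>dim\<close> vanishes exactly on subsets of {0}. The
  bound on \<open>dim\<close> and \<open>CARD('n) > 0\<close> settle the subtraction of naturals in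
  \<open>codim\<close>. In the plane this turns codimension 2 into the absence of nonzero fixed
  vectors.\<close>

lemma codim_fixed_space_eq_full_iff:
  "codim (fixed_space H :: (real^'n) set) = CARD('n) \<longleftrightarrow> fixed_space H = {0}"
proof -
  have "dim (fixed_space H) \<le> CARD('n)"
    using dim_subset_UNIV[of "fixed_space H"] by simp
  then have "codim (fixed_space H) = CARD('n) \<longleftrightarrow> dim (fixed_space H) = 0"
    using zero_less_card_finite[where 'a = 'n] by (simp add: codim_def del: dim_eq_0) linarith
  also have "\<dots> \<longleftrightarrow> fixed_space H = {0}"
    using zero_in_fixed_space[of H] by auto
  finally show ?thesis .
qed

lemma fixed_space_mat_1: "fixed_space {mat 1} = UNIV"
  by (simp add: fixed_space_def)

lemma codim_fixed_space_mat_1: "codim (fixed_space {mat 1 :: real^'n^'n}) = 0"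
  by (simp add: fixed_space_mat_1 codim_def)

lemma codim_fixed_space_le: "codim (fixed_space (H :: (real^'n^'n) set)) \<le> CARD('n)"
  by (simp add: codim_def)

section \<open>Subgroups of the general linear group\<close>

lemma carrier_GL [simp]: "carrier GL = {A. invertible A}"
  and mult_GL [simp]: "A \<otimes>\<^bsub>GL\<^esub> B = A ** B"
  and one_GL [simp]: "\<one>\<^bsub>GL\<^esub> = mat 1"
  by (simp_all add: GL_def)

lemma matrix_inv_eqI:
  fixes A :: "real^'n^'n"
  assumes "A ** B = mat 1" "B ** A = mat 1"
  shows "matrix_inv A = B"
proof -
  have "A ** matrix_inv A = mat 1"
    unfolding matrix_inv_def by (rule someI2[of _ B]) (simp_all add: assms)
  then have "B ** A ** matrix_inv A = B" by (simp add: matrix_mul_assoc[symmetric])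
  then show ?thesis by (simp add: assms)
qed

text \<open>Multiplication by \<open>s\<close> turns determinant 1 into determinant -1, so
  \<open>g = (g s) s^-1\<close> is a product of generators. The hypotheses speak of determinants
  because these survive conjugation, so the lemma applies to \<open>G\<close> itself and not only to
  its orthogonal conjugate.\<close>

lemma det_generated_in_codim_1:
  fixes G :: "(real^'n^'n) set"
  assumes G: "subgroup G GL"
    and det: "\<And>g. g \<in> G \<Longrightarrow> det g = 1 \<or> det g = -1"
    and refl: "\<And>g. g \<in> G \<Longrightarrow> det g = -1 \<Longrightarrow> codim (fixed_space {g}) \<le> 1"
    and s: "s \<in> G" "det s = -1"
  shows "generated_in_codim_1 G"
proof -
  interpret group "GL :: (real^'n^'n) monoid" by (rule group_GL)
  interpret G: subgroup G GL by (rule G)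
  let ?R = "{g \<in> G. codim (fixed_space {g}) \<le> 1}"
  have "g \<in> generate GL ?R" if g: "g \<in> G" for g
  proof (cases "det g = -1")
    case True
    then show ?thesis using g refl by (auto intro: generate.incl)
  next
    case False
    then have "det (g ** s) = -1" using det[OF g] s by (simp add: det_mul)
    moreover have gs: "g ** s \<in> G" using G.m_closed[OF g s(1)] by simp
    ultimately have 1: "g ** s \<in> generate GL ?R" using refl by (auto intro: generate.incl)
    have 2: "inv\<^bsub>GL\<^esub> s \<in> generate GL ?R" using s refl by (auto intro: generate.inv)
    have "(g \<otimes>\<^bsub>GL\<^esub> s) \<otimes>\<^bsub>GL\<^esub> inv\<^bsub>GL\<^esub> s = g"
      using G.mem_carrier[OF g] G.mem_carrier[OF s(1)] by (metis inv_solve_right m_closed inv_closed)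
    with generate.eng[OF 1 2] show ?thesis by simp
  qed
  moreover have "generate GL ?R \<subseteq> G"
    by (rule generate_subgroup_incl[OF _ G]) auto
  ultimately show ?thesis by (auto simp: generated_in_codim_1_def)
qed

section \<open>Invariant inner products\<close>

text \<open>The form is the sum over \<open>G\<close> of the translates of the dot product;
  translating by \<open>h\<close> only permutes the summands.\<close>

lemma finite_subgroup_GL_invariant_form:
  fixes G :: "(real^'n^'n) set"
  assumes G: "subgroup G GL" and "finite G"
  obtains B :: "real^'n \<Rightarrow> real^'n \<Rightarrow> real"
  where "bilinear B" "\<And>x y. B x y = B y x" "\<And>x. x \<noteq> 0 \<Longrightarrow> B x x > 0"
    "\<And>h x y. h \<in> G \<Longrightarrow> B (h *v x) (h *v y) = B x y"
proof
  interpret group "GL :: (real^'n^'n) monoid" by (rule group_GL)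
  interpret G: subgroup G GL by (rule G)
  define B where "B x y = (\<Sum>g\<in>G. (g *v x) \<bullet> (g *v y))" for x y
  show "bilinear B"
    unfolding bilinear_def B_def
    by (auto intro!: linearI simp: matrix_vector_right_distrib inner_add_left inner_add_right
        sum.distrib matrix_vector_mult_scaleR sum_distrib_left)
  show "B x y = B y x" for x y
    by (simp add: B_def inner_commute)
  show "B x x > 0" if "x \<noteq> 0" for x
  proof -
    \<comment> \<open>All summands are nonnegative, and the one at the identity is strictly
      positive.\<close>
    have "mat 1 \<in> G" using G.one_closed by simp
    moreover have "(mat 1 *v x) \<bullet> (mat 1 *v x) > 0" using that by simp
    ultimately show ?thesis unfolding B_def
      by (intro sum_pos2[OF \<open>finite G\<close>]) auto
  qed
  show "B (h *v x) (h *v y) = B x y" if h: "h \<in> G" for h x y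
  proof -
    \<comment> \<open>An injective right translation of the finite set \<open>G\<close> into itself
      is a permutation, which allows reindexing the sum.\<close>
    have inj: "inj_on (\<lambda>g. g ** h) G"
      using right_cancel G.subset h by (auto simp: inj_on_def)
    have "(\<lambda>g. g ** h) ` G = G"
      using G.m_closed h by (intro endo_inj_surj[OF \<open>finite G\<close> _ inj]) auto
    then have "B x y = (\<Sum>g\<in>(\<lambda>g. g ** h) ` G. (g *v x) \<bullet> (g *v y))"
      by (simp add: B_def)
    also have "\<dots> = B (h *v x) (h *v y)"
      by (simp add: sum.reindex[OF inj] B_def matrix_vector_mul_assoc)
    finally show ?thesis by simp
  qed
qed

text \<open>Completing the square: \<open>B x x\<close> equals
  \<open>a (x1 + (b/a) x2)^2 + (c - b^2/a) x2^2\<close>, and both coefficients are positive.\<close>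

lemma positive_definite_form_2:
  fixes B :: "real^2 \<Rightarrow> real^2 \<Rightarrow> real"
  assumes B: "bilinear B" and sym: "\<And>x y. B x y = B y x" and pos: "\<And>x. x \<noteq> 0 \<Longrightarrow> B x x > 0"
  obtains P :: "real^2^2" where "invertible P" "\<And>x y. B x y = (P *v x) \<bullet> (P *v y)"
proof -
  define a b c where "a = B (axis 1 1) (axis 1 1)" "b = B (axis 1 1) (axis 2 1)"
    "c = B (axis 2 1) (axis 2 1)"
  note bil = bilinear_ladd[OF B] bilinear_radd[OF B] bilinear_lmul[OF B] bilinear_rmul[OF B]
  have expand: "B x y = a * (x$1 * y$1) + b * (x$1 * y$2 + x$2 * y$1) + c * (x$2 * y$2)" for x y
  proof -
    have v: "v = v$1 *\<^sub>R axis 1 1 + v$2 *\<^sub>R axis 2 1" for v :: "real^2"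
      by (simp add: vec_eq_iff forall_2 axis_def)
    have "B x y = B (x$1 *\<^sub>R axis 1 1 + x$2 *\<^sub>R axis 2 1) (y$1 *\<^sub>R axis 1 1 + y$2 *\<^sub>R axis 2 1)"
      using v[of x] v[of y] by simp
    then show ?thesis
      using sym[of "axis 2 1" "axis 1 1"] by (simp add: bil a_b_c_def algebra_simps)
  qed
  have a: "a > 0"
    unfolding a_b_c_def by (rule pos) (simp add: axis_eq_0_iff)
  have d: "c - b\<^sup>2 / a > 0"
  proof -
    \<comment> \<open>This vector is \<open>B\<close>-orthogonal to the first axis; the first square
      vanishes on it, leaving exactly \<open>c - b^2/a\<close>.\<close>
    have "B (vector [- b / a, 1]) (vector [- b / a, 1]) > 0"
      by (rule pos) (simp add: vec_eq_iff forall_2)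
    then show ?thesis using a by (simp add: expand field_simps power2_eq_square)
  qed
  \<comment> \<open>The upper triangular Cholesky factor of the Gram matrix of
    \<open>B\<close>.\<close>
  define P :: "real^2^2"
    where "P = vector [vector [sqrt a, b / sqrt a], vector [0, sqrt (c - b\<^sup>2 / a)]]"
  have P: "B x y = (P *v x) \<bullet> (P *v y)" for x y
  proof -
    have *: "sqrt a * sqrt a = a" "sqrt (c - b\<^sup>2 / a) * sqrt (c - b\<^sup>2 / a) = c - b\<^sup>2 / a"
      using a d by simp_all
    have "(P *v x) \<bullet> (P *v y) = sqrt a * sqrt a * (x$1 * y$1) + b * (x$1 * y$2 + x$2 * y$1)
      + (b\<^sup>2 / (sqrt a * sqrt a) + sqrt (c - b\<^sup>2 / a) * sqrt (c - b\<^sup>2 / a)) * (x$2 * y$2)"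
      using a by (simp add: P_def matrix_vector_mult_def inner_vec_def sum_2 field_simps
          power2_eq_square del: real_sqrt_mult_self)
    then show ?thesis unfolding * by (simp add: expand)
  qed
  moreover have "invertible P"
    using a d by (simp add: invertible_det_nz P_def det_2)
  ultimately show ?thesis using that[of P] by simp
qed

text \<open>\<open>P\<close> carries the invariant form to the dot product, so conjugation by
  \<open>P\<close> carries maps preserving the form to orthogonal ones.\<close>

lemma finite_subgroup_GL_2_orthogonal:
  fixes G :: "(real^2^2) set"
  assumes "subgroup G GL" and "finite G"
  obtains P Q :: "real^2^2" where "P ** Q = mat 1" "Q ** P = mat 1"
    "\<And>g. g \<in> G \<Longrightarrow> orthogonal_matrix (P ** g ** Q)"
proof -
  obtain B :: "real^2 \<Rightarrow> real^2 \<Rightarrow> real"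
    where B: "bilinear B" "\<And>x y. B x y = B y x" "\<And>x. x \<noteq> 0 \<Longrightarrow> B x x > 0"
      and inv: "\<And>h x y. h \<in> G \<Longrightarrow> B (h *v x) (h *v y) = B x y"
    using finite_subgroup_GL_invariant_form[OF assms] by metis
  obtain P :: "real^2^2" where "invertible P" and P: "\<And>x y. B x y = (P *v x) \<bullet> (P *v y)"
    using positive_definite_form_2[OF B] by metis
  then obtain Q where PQ: "P ** Q = mat 1" "Q ** P = mat 1"
    by (auto simp: invertible_def)
  have "orthogonal_matrix (P ** g ** Q)" if "g \<in> G" for g
  proof -
    have "((P ** g ** Q) *v x) \<bullet> ((P ** g ** Q) *v y) = x \<bullet> y" for x y
    proof -
      have "((P ** g ** Q) *v x) \<bullet> ((P ** g ** Q) *v y) = B (Q *v x) (Q *v y)"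
        using P inv[OF that] by (simp add: matrix_vector_mul_assoc[symmetric])
      then show ?thesis by (simp add: P matrix_vector_mul_assoc PQ)
    qed
    then have "orthogonal_transformation ((*v) (P ** g ** Q))"
      by (simp add: orthogonal_transformation_def)
    then show ?thesis by (simp add: orthogonal_transformation_matrix)
  qed
  from that[OF PQ this] show ?thesis by blast
qed

section \<open>Orthogonal matrices and complex numbers\<close>

definition vec2 :: "complex \<Rightarrow> real^2"
  where "vec2 z = vector [Re z, Im z]"

text \<open>Multiplication by \<open>z\<close> under the identification \<open>vec2\<close>: for
  \<open>norm z = 1\<close>, the rotation by the argument of \<open>z\<close>.\<close>

definition rot :: "complex \<Rightarrow> real^2^2"
  where "rot z = vector [vector [Re z, - Im z], vector [Im z, Re z]]"

text \<open>The map sending \<open>w\<close> to \<open>z * cnj w\<close>: for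
  \<open>norm z = 1\<close>, the reflection in the line spanned by a square root of
  \<open>z\<close>.\<close>

definition rfl :: "complex \<Rightarrow> real^2^2"
  where "rfl z = vector [vector [Re z, Im z], vector [Im z, - Re z]]"

lemma vec2_eq_iff: "vec2 z = vec2 w \<longleftrightarrow> z = w"
  by (simp add: vec2_def vec_eq_iff forall_2 complex_eq_iff)

lemma vec2_cases: obtains z where "v = vec2 z"
proof
  show "v = vec2 (Complex (v$1) (v$2))" by (simp add: vec2_def vec_eq_iff forall_2)
qed

lemma vec2_0: "vec2 0 = 0"
  by (simp add: vec2_def vec_eq_iff forall_2)

lemma rot_vec2: "rot z *v vec2 w = vec2 (z * w)"
  by (simp add: rot_def vec2_def vec_eq_iff forall_2 matrix_vector_mult_def sum_2)

lemma rfl_vec2: "rfl z *v vec2 w = vec2 (z * cnj w)"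
  by (simp add: rfl_def vec2_def vec_eq_iff forall_2 matrix_vector_mult_def sum_2)

lemma rot_mult: "rot z ** rot w = rot (z * w)"
  by (simp add: rot_def vec_eq_iff forall_2 matrix_matrix_mult_def sum_2)

lemma rot_1: "rot 1 = mat 1"
  by (simp add: rot_def vec_eq_iff forall_2 mat_def)

lemma inj_rot: "inj rot"
  by (auto simp: inj_def rot_def vec_eq_iff forall_2 complex_eq_iff)

lemma det_rot: "det (rot z) = (norm z)\<^sup>2"
  unfolding cmod_power2 by (simp add: rot_def det_2 power2_eq_square)

lemma det_rfl: "det (rfl z) = - (norm z)\<^sup>2"
  unfolding cmod_power2 by (simp add: rfl_def det_2 power2_eq_square)

lemma orthogonal_rot: "norm z = 1 \<Longrightarrow> orthogonal_matrix (rot z)"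
  using cmod_power2[of z]
  by (simp add: orthogonal_matrix rot_def vec_eq_iff forall_2 matrix_matrix_mult_def sum_2
      transpose_def mat_def power2_eq_square)

text \<open>Given the unit first column (a, c), orthogonality and the sign of the determinant force
  the second column to be (-c, a) or (c, -a).\<close>

lemma orthogonal_matrix_2_cases:
  assumes "orthogonal_matrix (A :: real^2^2)"
  obtains z where "norm z = 1" "A = rot z" | z where "norm z = 1" "A = rfl z"
proof -
  define a b c d where "a = A$1$1" "b = A$1$2" "c = A$2$1" "d = A$2$2"
  have A: "A = vector [vector [a, b], vector [c, d]]"
    by (simp add: vec_eq_iff forall_2 a_b_c_d_def)
  have eqs: "a * a + c * c = 1" "a * b + c * d = 0" "b * b + d * d = 1"
    using assms by (simp_all add: orthogonal_matrix A vec_eq_iff forall_2 matrix_matrix_mult_def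
        sum_2 transpose_def mat_def)
  have nz: "norm (Complex a c) = 1"
    using eqs(1) by (simp add: cmod_def power2_eq_square)
  have "det A = 1 \<or> det A = -1"
    using assms by (rule det_orthogonal_matrix)
  then have "a * d - b * c = 1 \<or> a * d - b * c = -1"
    by (simp add: A det_2)
  then show ?thesis
  proof
    assume 1: "a * d - b * c = 1"
    have "b = - c" "d = a" using eqs 1 by algebra+
    then have "A = rot (Complex a c)" by (simp add: A rot_def)
    with nz show ?thesis by (rule that(1))
  next
    assume 1: "a * d - b * c = -1"
    have "b = c" "d = - a" using eqs 1 by algebra+
    then have "A = rfl (Complex a c)" by (simp add: A rfl_def)
    with nz show ?thesis by (rule that(2))
  qed
qed

text \<open>A square root \<open>w\<close> of \<open>z\<close> has norm 1, hence
  \<open>z * cnj w = w * (w * cnj w) = w\<close>.\<close>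

lemma rfl_fixed_vector:
  assumes "norm z = 1"
  obtains v where "v \<noteq> 0" "rfl z *v v = v"
proof
  let ?w = "csqrt z"
  have "norm ?w = 1" using assms by simp
  then have "?w * cnj ?w = 1" by (simp add: complex_norm_square[symmetric])
  then have "z * cnj ?w = ?w"
    by (metis mult.assoc mult.right_neutral power2_csqrt power2_eq_square)
  then show "rfl z *v vec2 ?w = vec2 ?w" by (simp add: rfl_vec2)
  show "vec2 ?w \<noteq> 0" using \<open>norm ?w = 1\<close> by (metis norm_zero vec2_0 vec2_eq_iff zero_neq_one)
qed

lemma rot_fixed_vector_iff: "rot z *v v = v \<longleftrightarrow> z = 1 \<or> v = 0"
proof -
  obtain w where "v = vec2 w" by (rule vec2_cases)
  then show ?thesis by (auto simp: rot_vec2 vec2_eq_iff vec2_0[symmetric])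
qed

lemma fixed_space_rot: "z \<noteq> 1 \<Longrightarrow> fixed_space {rot z} = {0}"
  by (auto simp: fixed_space_def rot_fixed_vector_iff)

lemma fixed_space_rfl: "norm z = 1 \<Longrightarrow> fixed_space {rfl z} \<noteq> {0}"
proof -
  assume "norm z = 1"
  then obtain v where "v \<noteq> 0" "rfl z *v v = v" by (rule rfl_fixed_vector)
  then have "v \<in> fixed_space {rfl z}" by (simp add: fixed_space_def)
  with \<open>v \<noteq> 0\<close> show ?thesis by blast
qed

section \<open>Roots of unity\<close>

text \<open>Multiplication by \<open>z\<close> permutes \<open>U\<close>, so the product of all
  elements equals itself times \<open>z ^ card U\<close>. Thus \<open>U\<close> consists of
  \<open>card U\<close>-th roots of unity, and there are only \<open>card U\<close> of
  these.\<close>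

lemma finite_unit_group_eq_roots_unity:
  fixes U :: "complex set"
  assumes "finite U" "1 \<in> U" "0 \<notin> U" and mult: "\<And>z w. z \<in> U \<Longrightarrow> w \<in> U \<Longrightarrow> z * w \<in> U"
  shows "U = {z. z ^ card U = 1}"
proof (rule card_subset_eq)
  have pos: "card U > 0" using assms by (auto simp: card_gt_0_iff)
  then show "finite {z :: complex. z ^ card U = 1}" by (intro finite_roots_unity) auto
  show "card U = card {z :: complex. z ^ card U = 1}" using pos by (simp add: card_roots_unity_eq)
  show "U \<subseteq> {z. z ^ card U = 1}"
  proof
    fix z assume z: "z \<in> U"
    have inj: "inj_on ((*) z) U" using z assms by (auto simp: inj_on_def)
    have "(*) z ` U = U" using z mult by (intro endo_inj_surj[OF \<open>finite U\<close> _ inj]) auto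
    then have "\<Prod>U = (\<Prod>w\<in>U. z * w)" using prod.reindex[OF inj, of id] by simp
    also have "\<dots> = z ^ card U * \<Prod>U" by (simp add: prod.distrib)
    \<comment> \<open>The product over \<open>U\<close> is nonzero because 0 is not in
      \<open>U\<close>, so it cancels.\<close>
    finally have "z ^ card U = 1" using assms by (auto simp: prod_zero_iff)
    then show "z \<in> {z. z ^ card U = 1}" by simp
  qed
qed

lemma norm_root_unity: "z ^ n = 1 \<Longrightarrow> n > 0 \<Longrightarrow> norm (z :: complex) = 1"
  by (metis norm_ge_zero norm_one norm_power power_eq_1_iff less_irrefl)

section \<open>Rotations in the dihedral groups\<close>

lemma circle_points_eq: "n > 0 \<Longrightarrow> circle_points n = vec2 ` {z. z ^ n = 1}"
proof -
  assume n: "n > 0"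
  have "{z :: complex. z ^ n = 1} = (\<lambda>k. cis (2 * pi * real k / real n)) ` {..<n}"
    using Complex.bij_betw_roots_unity[OF n] by (simp add: bij_betw_def)
  then show ?thesis by (simp add: circle_points_def image_image vec2_def)
qed

text \<open>Multiplication by an \<open>n\<close>-th root of unity permutes the \<open>n\<close>-th
  roots of unity, which are the points of the circle. For \<open>n = 2\<close> the two roots give
  the matrices \<open>diag(1, 1)\<close> and \<open>diag(-1, -1)\<close>.\<close>

lemma rot_in_I2:
  assumes n: "n \<ge> 2" and z: "z ^ n = 1"
  shows "rot z \<in> I\<^sub>2 n"
proof (cases "n = 2")
  case True
  then have "z = 1 \<or> z = -1" using z by (simp add: power2_eq_1_iff)
  then show ?thesis using True by (auto simp: I\<^sub>2_def rot_def) (metis add.inverse_neutral)+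
next
  case False
  have "z \<noteq> 0" using z n by (auto simp: power_0_left)
  have mult_roots: "(*) z ` {w. w ^ n = 1} = {w. w ^ n = 1}"
  proof (intro equalityI subsetI)
    fix w :: complex
    assume "w \<in> {w. w ^ n = 1}"
    then have "w / z \<in> {w. w ^ n = 1}" using z by (simp add: power_divide)
    then show "w \<in> (*) z ` {w. w ^ n = 1}"
      using \<open>z \<noteq> 0\<close> by (intro image_eqI[of _ _ "w / z"]) auto
  qed (use z in \<open>auto simp: power_mult_distrib\<close>)
  have "(*v) (rot z) ` vec2 ` {w. w ^ n = 1} = vec2 ` (*) z ` {w. w ^ n = 1}"
    by (simp add: image_image rot_vec2)
  then have "(*v) (rot z) ` circle_points n = circle_points n"
    using n by (simp add: circle_points_eq mult_roots)
  then show ?thesis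
    using False orthogonal_rot[OF norm_root_unity[OF z]] n by (simp add: I\<^sub>2_def)
qed

text \<open>Reflections have fixed vectors, so only rotations remain, and \<open>rot z\<close> moves
  the circle point 1 to \<open>z\<close>, which must then be a root of unity. For
  \<open>n = 2\<close> a diagonal entry 1 would fix a coordinate axis, leaving only
  \<open>diag(-1, -1)\<close>.\<close>

lemma I2_fixed_space_0:
  assumes n: "n \<ge> 2" and A: "A \<in> I\<^sub>2 n" "fixed_space {A} = {0}"
  obtains z where "z ^ n = 1" "A = rot z"
proof (cases "n = 2")
  case True
  then obtain a b where A': "A = vector [vector [a, 0], vector [0, b]]"
    and ab: "a \<in> {1, -1}" "b \<in> {1, -1}"
    using A(1) by (auto simp: I\<^sub>2_def)
  have "a \<noteq> 1"
  proof
    assume "a = 1"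
    then have "vec2 1 \<in> fixed_space {A}"
      by (simp add: A' fixed_space_def vec2_def vec_eq_iff forall_2 matrix_vector_mult_def sum_2)
    then show False using A(2) vec2_eq_iff[of 1 0] by (simp add: vec2_0)
  qed
  moreover have "b \<noteq> 1"
  proof
    assume "b = 1"
    then have "vec2 \<i> \<in> fixed_space {A}"
      by (simp add: A' fixed_space_def vec2_def vec_eq_iff forall_2 matrix_vector_mult_def sum_2)
    then show False using A(2) vec2_eq_iff[of \<i> 0] by (simp add: vec2_0)
  qed
  ultimately have "A = rot (-1)" using ab by (simp add: A' rot_def)
  with True show ?thesis by (intro that[of "-1"]) auto
next
  case False
  then have orth: "orthogonal_matrix A" and img: "(*v) A ` circle_points n = circle_points n"
    using A by (auto simp: I\<^sub>2_def)
  from orth show ?thesis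
  proof (cases rule: orthogonal_matrix_2_cases)
    case (1 z)
    have "vec2 1 \<in> circle_points n" using n by (simp add: circle_points_eq)
    then have "rot z *v vec2 1 \<in> circle_points n" using img 1 by blast
    then have "z ^ n = 1" using n by (auto simp: circle_points_eq rot_vec2 vec2_eq_iff)
    then show ?thesis using 1 that by blast
  next
    case (2 z)
    then show ?thesis using fixed_space_rfl A by blast
  qed
qed

text \<open>The generators are the rotations by the roots of unity other than 1. Together with the
  identity they already form a group, so generation adds only \<open>mat 1\<close>.\<close>

lemma mu2_eq:
  assumes n: "n \<ge> 2"
  shows "\<mu>\<^sub>2 n = rot ` {z. z ^ n = 1}"
proof -
  interpret group "GL :: (real^2^2) monoid" by (rule group_GL)
  let ?U = "{z :: complex. z ^ n = 1}"
  have gens: "{g \<in> I\<^sub>2 n. codim (fixed_space {g}) = 2} = rot ` (?U - {1})"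
  proof (intro equalityI subsetI)
    fix A assume "A \<in> {g \<in> I\<^sub>2 n. codim (fixed_space {g}) = 2}"
    then have A: "A \<in> I\<^sub>2 n" "fixed_space {A} = {0}"
      using codim_fixed_space_eq_full_iff[of "{A}"] by auto
    then obtain z where z: "z ^ n = 1" "A = rot z" by (rule I2_fixed_space_0[OF n])
    have "A \<noteq> mat 1"
      using A(2) codim_fixed_space_mat_1[where 'n = 2] codim_fixed_space_eq_full_iff[of "{A}"]
      by force
    then have "z \<noteq> 1" using z by (auto simp: rot_1)
    with z show "A \<in> rot ` (?U - {1})" by blast
  next
    fix A assume "A \<in> rot ` (?U - {1})"
    then obtain z where "z ^ n = 1" "z \<noteq> 1" "A = rot z" by blast
    then show "A \<in> {g \<in> I\<^sub>2 n. codim (fixed_space {g}) = 2}"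
      using rot_in_I2[OF n] fixed_space_rot codim_fixed_space_eq_full_iff[of "{A}"] by simp
  qed
  have inv_rot: "rot z ** rot (inverse z) = mat 1" "rot (inverse z) ** rot z = mat 1"
    if "z ^ n = 1" for z
  proof -
    have "z \<noteq> 0" using that n by (auto simp: power_0_left)
    then show "rot z ** rot (inverse z) = mat 1" "rot (inverse z) ** rot z = mat 1"
      by (simp_all add: rot_mult rot_1)
  qed
  have inv: "invertible (rot z)" if "z ^ n = 1" for z
    using inv_rot[OF that] by (auto simp: invertible_def)
  have "subgroup (rot ` ?U) GL"
  proof (rule subgroupI)
    show "rot ` ?U \<subseteq> carrier GL" using inv by auto
    show "rot ` ?U \<noteq> {}" by (auto intro: exI[of _ 1])
  next
    fix A assume "A \<in> rot ` ?U"
    then obtain z where z: "z ^ n = 1" "A = rot z" by blast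
    then have "inv\<^bsub>GL\<^esub> A = rot (inverse z)"
      using inv_rot[OF z(1)] inv[of z] inv[of "inverse z"]
      by (intro inv_equality) (auto simp: power_inverse)
    then show "inv\<^bsub>GL\<^esub> A \<in> rot ` ?U" using z by (auto simp: power_inverse)
  next
    fix A B assume "A \<in> rot ` ?U" "B \<in> rot ` ?U"
    then show "A \<otimes>\<^bsub>GL\<^esub> B \<in> rot ` ?U"
      by (auto simp: rot_mult power_mult_distrib intro!: imageI)
  qed
  then have "generate GL (rot ` (?U - {1})) \<subseteq> rot ` ?U"
    by (intro generate_subgroup_incl) auto
  moreover have "rot z \<in> generate GL (rot ` (?U - {1}))" if "z ^ n = 1" for z
    using that generate.one[of GL "rot ` (?U - {1})"]
    by (cases "z = 1") (auto simp: rot_1 intro!: generate.incl)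
  ultimately show ?thesis
    by (auto simp: \<mu>\<^sub>2_def rotation_subgroup_def gens)
qed

section \<open>Finite subgroups not generated in codimension 1\<close>

text \<open>Every nontrivial subgroup contains an element fixing only 0, so the arrangement has the
  single member {0}, attained by \<open>G\<close> itself.\<close>

lemma intersection_lattice_fixed_point_free:
  fixes G :: "(real^'n^'n) set"
  assumes G: "subgroup G GL" "G \<noteq> {mat 1}"
    and free: "\<And>g. g \<in> G \<Longrightarrow> g \<noteq> mat 1 \<Longrightarrow> fixed_space {g} = {0}"
  shows "carrier (\<L> (arrangement G)) = {{0}, UNIV}"
proof -
  have fixed: "fixed_space H = {0}" if H: "subgroup H GL" "H \<subseteq> G" "H \<noteq> {mat 1}" for H
  proof -
    have "mat 1 \<in> H" using subgroup.one_closed[OF H(1)] by simp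
    then obtain h where h: "h \<in> H" "h \<noteq> mat 1" using H(3) by blast
    then have "fixed_space H \<subseteq> fixed_space {h}" by (auto simp: fixed_space_def)
    also have "\<dots> = {0}" using h H free by blast
    finally show ?thesis using zero_in_fixed_space by blast
  qed
  have "stabilizer_subgroup G G"
    using G by (auto simp: stabilizer_subgroup_def fixed_space_def)
  then have "fixed_space G \<in> arrangement G" using G by (auto simp: arrangement_def)
  then have "{0} \<in> arrangement G" using fixed[OF G(1) subset_refl G(2)] by simp
  moreover have "arrangement G \<subseteq> {{0}}"
    using fixed by (auto simp: arrangement_def stabilizer_subgroup_def)
  ultimately have arr: "arrangement G = {{0}}" by blast
  show ?thesis
    unfolding intersection_lattice_def arr
    \<comment> \<open>The two subfamilies of \<open>{{0}}\<close>: the full one has intersection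
      {0}, the empty one has intersection \<open>UNIV\<close>.\<close>
    by (auto simp: subset_singleton_iff intro: exI[of _ "{{0}}"] exI[of _ "{}"])
qed

theorem proposition3p1:
  fixes G :: "(real^2^2) set"
  assumes "subgroup G GL" and "finite G" and "\<not> generated_in_codim_1 G"
  shows "\<R>\<^sub>1 G = {mat 1} \<and>
    (\<exists>n\<ge>2. conjugate_in_GL G (\<mu>\<^sub>2 n)) \<and>
    carrier (\<L> (arrangement G)) = {{0}, UNIV}"
proof -
  interpret group "GL :: (real^2^2) monoid" by (rule group_GL)
  interpret G: subgroup G GL by (rule assms(1))
  obtain P Q :: "real^2^2" where PQ: "P ** Q = mat 1" "Q ** P = mat 1"
    and orth: "\<And>g. g \<in> G \<Longrightarrow> orthogonal_matrix (P ** g ** Q)"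
    using finite_subgroup_GL_2_orthogonal[OF assms(1,2)] by metis
  have one: "mat 1 \<in> G" using G.one_closed by simp
  \<comment> \<open>Conjugation of \<open>G\<close> into the orthogonal group, followed by its
    inverse \<psi>.\<close>
  define \<phi> where "\<phi> g = P ** g ** Q" for g :: "real^2^2"
  define \<psi> where "\<psi> A = Q ** A ** P" for A :: "real^2^2"
  \<comment> \<open>Bracketing to the left cancels the pair of factors in front; bracketing to the
    right then cancels the pair at the end.\<close>
  have \<psi>\<phi>: "\<psi> (\<phi> g) = g" and \<phi>\<psi>: "\<phi> (\<psi> g) = g" for g
    by (simp_all add: \<phi>_def \<psi>_def matrix_mul_assoc PQ)
      (simp_all add: matrix_mul_assoc[symmetric] PQ)
  have \<phi>_mult: "\<phi> g ** \<phi> h = \<phi> (g ** h)" for g h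
  proof -
    have "\<phi> g ** \<phi> h = P ** g ** (Q ** P) ** h ** Q"
      by (simp only: \<phi>_def matrix_mul_assoc)
    then show ?thesis by (simp add: \<phi>_def PQ matrix_mul_assoc)
  qed
  have \<phi>_1: "\<phi> (mat 1) = mat 1" by (simp add: \<phi>_def PQ)
  have det_\<phi>: "det (\<phi> g) = det g" for g
  proof -
    have "det P * det Q = 1" using PQ by (metis det_I det_mul)
    then show ?thesis by (simp add: \<phi>_def det_mul)
  qed
  have fixed_\<phi>: "(\<phi> g) *v v = v \<longleftrightarrow> g *v (Q *v v) = Q *v v" for g v
  proof -
    have "\<phi> g *v v = P *v (g *v (Q *v v))"
      by (simp add: \<phi>_def matrix_vector_mul_assoc matrix_mul_assoc)
    then show ?thesis
      by (metis PQ matrix_vector_mul_assoc matrix_vector_mul_lid)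
  qed
  have Q0: "Q *v v = 0 \<longleftrightarrow> v = 0" for v
    by (metis PQ(1) matrix_vector_mul_assoc matrix_vector_mul_lid matrix_vector_mult_0_right)
  have P0: "P *v v = 0 \<longleftrightarrow> v = 0" for v
    by (metis PQ(2) matrix_vector_mul_assoc matrix_vector_mul_lid matrix_vector_mult_0_right)

  have cases: "(\<exists>z. norm z = 1 \<and> \<phi> g = rot z) \<or> (\<exists>z. norm z = 1 \<and> \<phi> g = rfl z)" if "g \<in> G" for g
    using orthogonal_matrix_2_cases[OF orth[OF that]] unfolding \<phi>_def by metis
  have det: "det g = 1 \<or> det g = -1" if "g \<in> G" for g
    using cases[OF that] det_\<phi>[of g] by (auto simp: det_rot det_rfl)
  have refl: "codim (fixed_space {g}) \<le> 1" if g: "g \<in> G" "det g = -1" for g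
  proof -
    obtain z where z: "norm z = 1" "\<phi> g = rfl z"
      using cases[OF g(1)] g(2) det_\<phi>[of g] by (auto simp: det_rot)
    obtain v where "v \<noteq> 0" "rfl z *v v = v" using rfl_fixed_vector[OF z(1)] .
    then have "Q *v v \<in> fixed_space {g}" "Q *v v \<noteq> 0"
      using fixed_\<phi>[of g v] Q0 z by (auto simp: fixed_space_def)
    then have "codim (fixed_space {g}) \<noteq> 2"
      using codim_fixed_space_eq_full_iff[of "{g}"] by auto
    then show ?thesis using codim_fixed_space_le[of "{g}"] by simp
  qed
  have rot: "\<exists>z. norm z = 1 \<and> \<phi> g = rot z" if g: "g \<in> G" for g
  proof -
    \<comment> \<open>An element of determinant -1 would make \<open>G\<close> generated in
      codimension 1.\<close>
    have "det g = 1"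
      using det_generated_in_codim_1[OF assms(1) det refl] det g assms(3) by blast
    then show ?thesis using cases[OF g] det_\<phi>[of g] by (auto simp: det_rfl)
  qed
  have free: "fixed_space {g} = {0}" if g: "g \<in> G" "g \<noteq> mat 1" for g
  proof -
    obtain z where z: "\<phi> g = rot z" using rot[OF g(1)] by blast
    have "z \<noteq> 1" using z g(2) \<psi>\<phi>[of g] \<psi>\<phi>[of "mat 1"] \<phi>_1 by (auto simp: rot_1)
    have "v = 0" if "g *v v = v" for v
    proof -
      \<comment> \<open>\<open>P\<close> carries vectors fixed by \<open>g\<close> to vectors fixed
        by the rotation \<open>\<phi> g\<close>, which is not the identity.\<close>
      have "\<phi> g *v (P *v v) = P *v v"
        unfolding fixed_\<phi> using that by (simp add: matrix_vector_mul_assoc PQ)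
      then show ?thesis using \<open>z \<noteq> 1\<close> z P0 by (simp add: rot_fixed_vector_iff)
    qed
    then show ?thesis by (auto simp: fixed_space_def)
  qed
  have codim: "codim (fixed_space {g}) = (if g = mat 1 then 0 else 2)" if "g \<in> G" for g
    using free[OF that] codim_fixed_space_eq_full_iff[of "{g}"] codim_fixed_space_mat_1[where 'n = 2]
    by (cases "g = mat 1") simp_all
  \<comment> \<open>Codimensions in \<open>G\<close> are only 0 or 2, so the reflection subgroup is
    generated by the empty set.\<close>
  have "{g \<in> G. codim (fixed_space {g}) = 1} = {}"
    using codim by auto
  then have R1: "\<R>\<^sub>1 G = {mat 1}"
    unfolding reflection_subgroup_def using generate_empty by (simp only: one_GL)
  have nontriv: "G \<noteq> {mat 1}"
  \<comment> \<open>The trivial group is generated by its identity, an element of codimension 0;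
    excluding it is what gives \<open>n \<ge> 2\<close>.\<close>
  proof
    assume G1: "G = {mat 1}"
    then have "{g \<in> G. codim (fixed_space {g}) \<le> 1} = {\<one>\<^bsub>GL\<^esub>}" using codim by auto
    then have "generated_in_codim_1 G" using G1 generate_one by (simp add: generated_in_codim_1_def)
    then show False using assms(3) by simp
  qed

  \<comment> \<open>The complex numbers whose rotations make up the conjugated group;
    \<open>rot\<close> and \<phi> are injective, so \<open>U\<close> has as many elements as
    \<open>G\<close>.\<close>
  define U where "U = {z. rot z \<in> \<phi> ` G}"
  have img: "rot ` U = \<phi> ` G"
  proof
    show "rot ` U \<subseteq> \<phi> ` G" by (auto simp: U_def)
    show "\<phi> ` G \<subseteq> rot ` U"
    proof
      fix A assume A: "A \<in> \<phi> ` G"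
      then obtain z where "A = rot z" using rot by blast
      with A show "A \<in> rot ` U" by (simp add: U_def)
    qed
  qed
  have inj\<phi>: "inj_on \<phi> G" by (metis \<psi>\<phi> inj_onI)
  have card: "card U = card G"
    using card_image[OF inj\<phi>] card_image[OF inj_on_subset[OF inj_rot subset_UNIV], of U] img by simp
  have "finite (rot ` U)" using img assms(2) by simp
  then have "finite U" using finite_imageD[OF _ inj_on_subset[OF inj_rot subset_UNIV]] by blast
  have "U = {z. z ^ card U = 1}"
  proof (rule finite_unit_group_eq_roots_unity[OF \<open>finite U\<close>])
    show "1 \<in> U" using one \<phi>_1 by (auto simp: U_def rot_1 intro: image_eqI[of _ _ "mat 1"])
    show "0 \<notin> U"
    proof
      assume "0 \<in> U"
      then obtain g where "g \<in> G" "\<phi> g = rot 0" by (auto simp: U_def)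
      \<comment> \<open>\<open>rot 0\<close> has determinant 0, whereas elements of \<open>G\<close>
        have determinant 1 or -1.\<close>
      then show False using det[of g] det_\<phi>[of g] by (auto simp: det_rot)
    qed
    show "z * w \<in> U" if "z \<in> U" "w \<in> U" for z w
    proof -
      from that obtain g h where gh: "g \<in> G" "h \<in> G" "rot z = \<phi> g" "rot w = \<phi> h"
        by (auto simp: U_def)
      then have "rot (z * w) = \<phi> (g ** h)" by (simp add: rot_mult[symmetric] \<phi>_mult)
      then show ?thesis using G.m_closed[OF gh(1,2)] by (auto simp: U_def)
    qed
  qed
  moreover have "card G \<ge> 2"
  proof -
    obtain g where "g \<in> G" "g \<noteq> mat 1" using one nontriv by blast
    then have "card {mat 1, g} \<le> card G" using one assms(2) by (intro card_mono) auto
    then show ?thesis using \<open>g \<noteq> mat 1\<close> by simp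
  qed
  ultimately have mu: "\<mu>\<^sub>2 (card G) = \<phi> ` G"
    using mu2_eq[of "card G"] card img by simp
  \<comment> \<open>Going back from \<open>\<mu>\<^sub>2 (card G)\<close> to \<open>G\<close> is
    conjugation by \<open>Q\<close>, whose inverse is \<open>P\<close>.\<close>
  have "G = \<psi> ` \<phi> ` G" by (simp add: image_image \<psi>\<phi>)
  moreover have "invertible Q" using PQ by (auto simp: invertible_def)
  moreover have "matrix_inv Q = P"
    using PQ by (intro matrix_inv_eqI)
  ultimately have "conjugate_in_GL G (\<mu>\<^sub>2 (card G))"
    unfolding conjugate_in_GL_def mu by (intro bexI[of _ Q]) (simp_all add: \<psi>_def)
  with \<open>card G \<ge> 2\<close> R1 intersection_lattice_fixed_point_free[OF assms(1) nontriv free]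
  show ?thesis by blast
qed

end
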